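(* Let $L$ be a loop and let $\mathcal{M}_\ell(L)$ be its left multiplication group. If $\mathcal{M}_\ell(L)$ is a simple group, then $L$ is a simple loop.
   Context: A loop is a set $L$ with a binary operation $(x,y)\mapsto xy$ (not assumed associative) having a two-sided identity element $1$ and such that for all $a,b\in L$ each of the equations $ax=b$ and $ya=b$ has a unique solution $x$, resp. $y$, in $L$. For $x\in L$ the left translation $\lambda_x:L\to L$, $\lambda_x(y):=xy$, is a permutation of $L$; the left multiplication group is $\mathcal{M}_\ell(L):=\langle \lambda_x : x\in L\rangle$, the subgroup of the symmetric group on $L$ generated by all left translations. A subloop of $L$ is a subset that is a loop under the restricted operation. A subloop $N$ of $L$ is normal if $(ab)N = a(bN) = (aN)b$ for all $a,b\in L$. A loop $L$ is simple if every normal subloop is trivial, i.e. equals $\{1\}$ or $L$. *)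

theory Defs
  imports "HOL-Algebra.Algebra"
begin

locale loop =
  fixes L (structure)
  assumes m_closed: "\<lbrakk>x \<in> carrier L; y \<in> carrier L\<rbrakk> \<Longrightarrow> x \<otimes> y \<in> carrier L"
    and one_closed: "\<one> \<in> carrier L"
    and l_one: "x \<in> carrier L \<Longrightarrow> \<one> \<otimes> x = x"
    and r_one: "x \<in> carrier L \<Longrightarrow> x \<otimes> \<one> = x"
    and l_solvable: "\<lbrakk>a \<in> carrier L; b \<in> carrier L\<rbrakk> \<Longrightarrow> \<exists>!x. x \<in> carrier L \<and> a \<otimes> x = b"
    and r_solvable: "\<lbrakk>a \<in> carrier L; b \<in> carrier L\<rbrakk> \<Longrightarrow> \<exists>!y. y \<in> carrier L \<and> y \<otimes> a = b"

(* BijGroup represents permutations of carrier L as functions that are extensional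
   (undefined outside carrier L), hence the restricted lambda. *)
definition left_translation :: "('a, 'b) monoid_scheme \<Rightarrow> 'a \<Rightarrow> 'a \<Rightarrow> 'a"
  where "left_translation L x = (\<lambda>y\<in>carrier L. x \<otimes>\<^bsub>L\<^esub> y)"

definition left_mult_group :: "('a, 'b) monoid_scheme \<Rightarrow> ('a \<Rightarrow> 'a) monoid"
  where "left_mult_group L =
    subgroup_generated (BijGroup (carrier L)) (left_translation L ` carrier L)"

(* subgroup_generated G S silently intersects S with carrier G; for a loop L nothing is lost. *)
lemma (in loop) left_translation_in_BijGroup:
  assumes "x \<in> carrier L"
  shows "left_translation L x \<in> carrier (BijGroup (carrier L))"
proof -
  have "bij_betw (left_translation L x) (carrier L) (carrier L)"
    unfolding bij_betw_def
  proof
    show "inj_on (left_translation L x) (carrier L)"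
      using assms l_solvable m_closed by (auto simp: inj_on_def left_translation_def)
    show "left_translation L x ` carrier L = carrier L"
    proof
      show "left_translation L x ` carrier L \<subseteq> carrier L"
        using assms m_closed by (auto simp: left_translation_def)
      show "carrier L \<subseteq> left_translation L x ` carrier L"
      proof
        fix b assume "b \<in> carrier L"
        then obtain y where "y \<in> carrier L" "x \<otimes> y = b"
          using assms l_solvable by blast
        then show "b \<in> left_translation L x ` carrier L"
          by (auto simp: left_translation_def image_iff)
      qed
    qed
  qed
  then show ?thesis
    by (simp add: BijGroup_def Bij_def left_translation_def)
qed

(* The identity of a subloop is not presupposed to be that of L; that they agree is a consequence. *)
definition subloop :: "'a set \<Rightarrow> ('a, 'b) monoid_scheme \<Rightarrow> bool"
  where "subloop N L \<longleftrightarrow>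
    N \<subseteq> carrier L \<and> (\<exists>e. loop (L\<lparr>carrier := N, one := e\<rparr>))"

definition normal_subloop :: "'a set \<Rightarrow> ('a, 'b) monoid_scheme \<Rightarrow> bool"
  where "normal_subloop N L \<longleftrightarrow> subloop N L \<and>
    (\<forall>a\<in>carrier L. \<forall>b\<in>carrier L.
      (a \<otimes>\<^bsub>L\<^esub> b) <#\<^bsub>L\<^esub> N = a <#\<^bsub>L\<^esub> (b <#\<^bsub>L\<^esub> N) \<and>
      a <#\<^bsub>L\<^esub> (b <#\<^bsub>L\<^esub> N) = (a <#\<^bsub>L\<^esub> N) #>\<^bsub>L\<^esub> b)"

(* The one-element loop counts as simple, whereas a simple group is required to be nontrivial below. *)
definition simple_loop :: "('a, 'b) monoid_scheme \<Rightarrow> bool"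
  where "simple_loop L \<longleftrightarrow> loop L \<and>
    (\<forall>N. normal_subloop N L \<longrightarrow> N = {\<one>\<^bsub>L\<^esub>} \<or> N = carrier L)"

(* The locale simple_group of HOL-Algebra requires order G > 1, where order is the cardinality
   as a natural number; this excludes infinite groups, whose order is 0. *)
definition abstract_simple_group :: "('a, 'b) monoid_scheme \<Rightarrow> bool"
  where "abstract_simple_group G \<longleftrightarrow> group G \<and> carrier G \<noteq> {\<one>\<^bsub>G\<^esub>} \<and>
    (\<forall>H. H \<lhd> G \<longrightarrow> H = {\<one>\<^bsub>G\<^esub>} \<or> H = carrier G)"

end

(* A normal subloop N is trivial or all of L because the left multiplication group permutes the
   cosets xN, and the kernel of this action is a normal subgroup.  If the kernel is everything,
   then aN = N for all a, so N = L.  The kernel contains every left translation by some n in N,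
   since n(bN) = (nN)b = Nb = 1(bN) = bN; so if the kernel is trivial, then N = {1}. *)
theory Submission
  imports Defs
begin

text \<open>Products in \<open>BijGroup S\<close> are composites restricted to \<open>S\<close> and
  \<open>undefined\<close> elsewhere, so they act on images as expected only for subsets of
  \<open>S\<close>.\<close>

lemma BijGroup_mult_image:
  assumes "f \<in> Bij S" "g \<in> Bij S" "A \<subseteq> S"
  shows "(f \<otimes>\<^bsub>BijGroup S\<^esub> g) ` A = f ` g ` A"
  using assms by (force simp: BijGroup_def compose_def image_image intro!: image_cong)

lemma BijGroup_one_image:
  assumes "A \<subseteq> S"
  shows "\<one>\<^bsub>BijGroup S\<^esub> ` A = A"
  using assms by (force simp: BijGroup_def)

lemma BijGroup_inv_image:
  assumes "f \<in> Bij S" "A \<subseteq> S"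
  shows "(inv\<^bsub>BijGroup S\<^esub> f) ` f ` A = A"
proof -
  interpret B: group "BijGroup S" by (rule group_BijGroup)
  have f: "f \<in> carrier (BijGroup S)"
    using assms by (simp add: BijGroup_def)
  then have "inv\<^bsub>BijGroup S\<^esub> f \<in> Bij S"
    using B.inv_closed[OF f] by (simp add: BijGroup_def)
  then have "(inv\<^bsub>BijGroup S\<^esub> f) ` f ` A = (inv\<^bsub>BijGroup S\<^esub> f \<otimes>\<^bsub>BijGroup S\<^esub> f) ` A"
    using assms by (simp add: BijGroup_mult_image)
  then show ?thesis
    using assms f by (simp add: BijGroup_one_image)
qed

text \<open>This reduces invariance of \<open>P\<close> under a generated group to invariance under
  its generators. The condition is an equality because an inclusion need not pass to inverses when
  \<open>P\<close> is infinite.\<close>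

lemma subgroup_family_stabilizer:
  assumes P: "P \<subseteq> Pow S"
  shows "subgroup {f \<in> Bij S. (\<lambda>A. f ` A) ` P = P} (BijGroup S)" (is "subgroup ?K _")
proof -
  interpret B: group "BijGroup S" by (rule group_BijGroup)
  have car: "carrier (BijGroup S) = Bij S"
    by (simp add: BijGroup_def)
  have sub: "\<And>A. A \<in> P \<Longrightarrow> A \<subseteq> S"
    using P by blast
  show ?thesis
  proof (rule B.subgroupI)
    show "?K \<subseteq> carrier (BijGroup S)"
      by (auto simp: car)
    have "\<one>\<^bsub>BijGroup S\<^esub> \<in> ?K"
      using B.one_closed sub by (simp add: car BijGroup_one_image)
    then show "?K \<noteq> {}" by blast
  next
    fix f assume f: "f \<in> ?K"
    have "(\<lambda>A. (inv\<^bsub>BijGroup S\<^esub> f) ` A) ` P = (\<lambda>A. (inv\<^bsub>BijGroup S\<^esub> f) ` A) ` (\<lambda>A. f ` A) ` P"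
      using f by simp
    also have "\<dots> = (\<lambda>A. A) ` P"
      \<comment> \<open>This instance merges only the two images of families; the nested images of
        each \<open>A\<close> keep the shape that \<open>BijGroup_inv_image\<close>
        rewrites.\<close>
      unfolding image_image[of "\<lambda>A. (inv\<^bsub>BijGroup S\<^esub> f) ` A"]
      using f sub by (intro image_cong[OF refl]) (simp add: BijGroup_inv_image)
    also have "\<dots> = P" by simp
    finally show "inv\<^bsub>BijGroup S\<^esub> f \<in> ?K"
      using f B.inv_closed[of f] by (simp add: car)
  next
    fix f g assume f: "f \<in> ?K" and g: "g \<in> ?K"
    have "(\<lambda>A. (f \<otimes>\<^bsub>BijGroup S\<^esub> g) ` A) ` P = (\<lambda>A. f ` g ` A) ` P"
      using f g sub by (intro image_cong[OF refl]) (simp add: BijGroup_mult_image)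
    also have "\<dots> = (\<lambda>A. f ` A) ` (\<lambda>A. g ` A) ` P"
      by (simp only: image_image)
    also have "\<dots> = P"
      using f g by simp
    finally show "f \<otimes>\<^bsub>BijGroup S\<^esub> g \<in> ?K"
      using f g B.m_closed[of f g] by (simp add: car)
  qed
qed

text \<open>The set is the kernel of the action of \<open>H\<close> on \<open>P\<close>. It is
  closed under conjugation because the inverse of \<open>f\<close> moves \<open>A\<close> to a
  member of \<open>P\<close>, which \<open>k\<close> fixes, and \<open>f\<close> moves that member
  back to \<open>A\<close>. Inclusion suffices in \<open>HP\<close>, since it also covers the
  inverses of elements of \<open>H\<close>.\<close>

lemma normal_family_kernel:
  assumes P: "P \<subseteq> Pow S"
    and H: "subgroup H (BijGroup S)"
    and HP: "\<And>f A. f \<in> H \<Longrightarrow> A \<in> P \<Longrightarrow> f ` A \<in> P"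
  shows "{f \<in> H. \<forall>A\<in>P. f ` A = A} \<lhd> (BijGroup S)\<lparr>carrier := H\<rparr>" (is "?K \<lhd> ?G")
proof -
  interpret B: group "BijGroup S" by (rule group_BijGroup)
  interpret G: group ?G by (rule B.subgroup_imp_group[OF H])
  have inv_eq: "inv\<^bsub>?G\<^esub> f = inv\<^bsub>BijGroup S\<^esub> f" if "f \<in> H" for f
    using B.m_inv_consistent[OF H that] .
  have Bij: "f \<in> Bij S" if "f \<in> H" for f
    using subgroup.mem_carrier[OF H that] by (simp add: BijGroup_def)
  have sub: "A \<subseteq> S" if "A \<in> P" for A
    using P that by blast
  have inv_in: "inv\<^bsub>BijGroup S\<^esub> f \<in> H" if "f \<in> H" for f
    using subgroup.m_inv_closed[OF H that] .
  have mult_in: "f \<otimes>\<^bsub>BijGroup S\<^esub> g \<in> H" if "f \<in> H" "g \<in> H" for f g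
    using subgroup.m_closed[OF H that] .
  have mult: "(f \<otimes>\<^bsub>BijGroup S\<^esub> g) ` A = f ` g ` A" if "f \<in> H" "g \<in> H" "A \<in> P" for f g A
    using that by (intro BijGroup_mult_image Bij sub)
  have inv: "(inv\<^bsub>BijGroup S\<^esub> f) ` f ` A = A" if "f \<in> H" "A \<in> P" for f A
    using that by (intro BijGroup_inv_image Bij sub)
  have inv': "f ` (inv\<^bsub>BijGroup S\<^esub> f) ` A = A" if "f \<in> H" "A \<in> P" for f A
    using inv[OF inv_in[OF that(1)] that(2)] subgroup.mem_carrier[OF H that(1)] by simp
  have "subgroup ?K ?G"
  proof (rule G.subgroupI)
    show "?K \<subseteq> carrier ?G" by auto
    have "\<one>\<^bsub>BijGroup S\<^esub> \<in> ?K"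
      using subgroup.one_closed[OF H] sub by (simp add: BijGroup_one_image)
    then show "?K \<noteq> {}" by blast
  next
    fix f assume "f \<in> ?K"
    then have f: "f \<in> H" "\<And>A. A \<in> P \<Longrightarrow> f ` A = A" by blast+
    then have "(inv\<^bsub>BijGroup S\<^esub> f) ` A = A" if "A \<in> P" for A
      using inv[of f A] that by simp
    then show "inv\<^bsub>?G\<^esub> f \<in> ?K"
      using f inv_in by (simp add: inv_eq)
  next
    fix f g assume "f \<in> ?K" "g \<in> ?K"
    then show "f \<otimes>\<^bsub>?G\<^esub> g \<in> ?K"
      by (simp add: mult mult_in)
  qed
  moreover have "f \<otimes>\<^bsub>?G\<^esub> k \<otimes>\<^bsub>?G\<^esub> inv\<^bsub>?G\<^esub> f \<in> ?K" if "f \<in> carrier ?G" "k \<in> ?K" for f k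
    using that by (simp add: inv_eq mult mult_in inv_in HP inv')
  ultimately show ?thesis
    by (intro G.normal_inv_iff[THEN iffD2] conjI ballI)
qed

context loop
begin

text \<open>This translates between cosets and the action of permutations on subsets, to which the
  kernel argument applies.\<close>

lemma l_coset_eq_image:
  assumes "A \<subseteq> carrier L"
  shows "a <#\<^bsub>L\<^esub> A = left_translation L a ` A"
  using assms by (force simp: l_coset_def left_translation_def)

text \<open>The identity \<open>e\<close> of the subloop is idempotent, so \<open>e\<close> and
  \<open>\<one>\<close> both solve \<open>e \<otimes> x = e\<close> in \<open>L\<close>, and
  uniqueness of the solution identifies them.\<close>

lemma subloop_one_mem:
  assumes "subloop N L"
  shows "\<one> \<in> N"
proof -
  from assms obtain e where N: "N \<subseteq> carrier L" and "loop (L\<lparr>carrier := N, one := e\<rparr>)"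
    by (auto simp: subloop_def)
  then interpret N: loop "L\<lparr>carrier := N, one := e\<rparr>" by simp
  have e: "e \<in> N" "e \<otimes> e = e"
    using N.one_closed N.l_one[of e] by simp_all
  then have "e = \<one>"
    using N l_solvable[of e e] one_closed r_one by blast
  with e show ?thesis by simp
qed

text \<open>Closure of \<open>N\<close> gives one inclusion; solvability of
  \<open>n \<otimes> x = m\<close> inside \<open>N\<close> gives the other.\<close>

lemma subloop_l_coset:
  assumes "subloop N L" "n \<in> N"
  shows "n <#\<^bsub>L\<^esub> N = N"
proof -
  from assms obtain e where "loop (L\<lparr>carrier := N, one := e\<rparr>)"
    by (auto simp: subloop_def)
  then interpret N: loop "L\<lparr>carrier := N, one := e\<rparr>" .
  have "n \<otimes> m \<in> N" if "m \<in> N" for m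
    using N.m_closed[of n m] assms(2) that by simp
  moreover have "\<exists>x\<in>N. n \<otimes> x = m" if "m \<in> N" for m
    using N.l_solvable[of n m] assms(2) that by auto
  ultimately show ?thesis
    by (auto simp: l_coset_def)
qed

lemma l_coset_closed:
  assumes "A \<subseteq> carrier L" "a \<in> carrier L"
  shows "a <#\<^bsub>L\<^esub> A \<subseteq> carrier L"
  using assms m_closed by (auto simp: l_coset_def)

lemma one_l_coset:
  assumes "A \<subseteq> carrier L"
  shows "\<one> <#\<^bsub>L\<^esub> A = A"
  using assms l_one by (force simp: l_coset_def)

lemma normal_subloop_l_coset_mult:
  assumes "normal_subloop N L" "a \<in> carrier L" "b \<in> carrier L"
  shows "a <#\<^bsub>L\<^esub> (b <#\<^bsub>L\<^esub> N) = (a \<otimes> b) <#\<^bsub>L\<^esub> N"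
  using assms by (simp add: normal_subloop_def)

lemma normal_subloop_l_coset_absorb:
  assumes N: "normal_subloop N L" and n: "n \<in> N" and b: "b \<in> carrier L"
  shows "n <#\<^bsub>L\<^esub> (b <#\<^bsub>L\<^esub> N) = b <#\<^bsub>L\<^esub> N"
proof -
  have sub: "subloop N L" and NL: "N \<subseteq> carrier L"
    using N by (auto simp: normal_subloop_def subloop_def)
  have "n <#\<^bsub>L\<^esub> (b <#\<^bsub>L\<^esub> N) = (n <#\<^bsub>L\<^esub> N) #> b"
    using N n b NL by (auto simp: normal_subloop_def)
  \<comment> \<open>Both cosets equal \<open>N\<close>; the second form lets the normality identity
    apply again, with \<open>\<one>\<close> in place of \<open>n\<close>.\<close>
  also have "\<dots> = (\<one> <#\<^bsub>L\<^esub> N) #> b"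
    using sub n NL by (simp add: subloop_l_coset one_l_coset)
  also have "\<dots> = \<one> <#\<^bsub>L\<^esub> (b <#\<^bsub>L\<^esub> N)"
    using N b one_closed by (simp add: normal_subloop_def)
  also have "\<dots> = b <#\<^bsub>L\<^esub> N"
    using NL b by (simp add: one_l_coset l_coset_closed)
  finally show ?thesis .
qed

text \<open>The intersection in \<open>subgroup_generated\<close> changes nothing because left
  translations are permutations. The result has the shape of the group in
  \<open>normal_family_kernel\<close>.\<close>

lemma left_mult_group_eq:
  "left_mult_group L = (BijGroup (carrier L))\<lparr>carrier :=
     generate (BijGroup (carrier L)) (left_translation L ` carrier L)\<rparr>"
proof -
  have "carrier (BijGroup (carrier L)) \<inter> left_translation L ` carrier L
      = left_translation L ` carrier L"
    using left_translation_in_BijGroup by blast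
  then show ?thesis
    by (simp add: left_mult_group_def subgroup_generated_def)
qed

text \<open>Translation by \<open>a\<close> sends the coset of \<open>b\<close> to that of
  \<open>a \<otimes> b\<close>, and every element of \<open>L\<close> has the form
  \<open>a \<otimes> b\<close>. So all generators lie in the stabilizer of the family of cosets,
  which is a subgroup and hence contains all they generate.\<close>

lemma left_mult_group_permutes_cosets:
  assumes N: "normal_subloop N L"
    and f: "f \<in> generate (BijGroup (carrier L)) (left_translation L ` carrier L)"
  shows "(\<lambda>A. f ` A) ` (\<lambda>b. b <#\<^bsub>L\<^esub> N) ` carrier L = (\<lambda>b. b <#\<^bsub>L\<^esub> N) ` carrier L"
proof -
  interpret B: group "BijGroup (carrier L)" by (rule group_BijGroup)
  define P where "P = (\<lambda>b. b <#\<^bsub>L\<^esub> N) ` carrier L"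
  have NL: "N \<subseteq> carrier L"
    using N by (simp add: normal_subloop_def subloop_def)
  have "(\<lambda>A. left_translation L a ` A) ` P = P" if a: "a \<in> carrier L" for a
  proof -
    have "(\<lambda>A. left_translation L a ` A) ` P = (\<lambda>b. (a \<otimes> b) <#\<^bsub>L\<^esub> N) ` carrier L"
      unfolding P_def image_image[of "\<lambda>A. left_translation L a ` A"]
    proof (rule image_cong[OF refl])
      fix b assume b: "b \<in> carrier L"
      show "left_translation L a ` (b <#\<^bsub>L\<^esub> N) = (a \<otimes> b) <#\<^bsub>L\<^esub> N"
        using normal_subloop_l_coset_mult[OF N a b] l_coset_eq_image[OF l_coset_closed[OF NL b], of a]
        by simp
    qed
    also have "\<dots> = (\<lambda>b. b <#\<^bsub>L\<^esub> N) ` (\<lambda>b. a \<otimes> b) ` carrier L"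
      by (simp only: image_image)
    also have "(\<lambda>b. a \<otimes> b) ` carrier L = carrier L"
      using m_closed[OF a] l_solvable[OF a] by blast
    finally show ?thesis by (simp only: P_def)
  qed
  then have "left_translation L ` carrier L \<subseteq> {f \<in> Bij (carrier L). (\<lambda>A. f ` A) ` P = P}"
    using left_translation_in_BijGroup by (auto simp: BijGroup_def)
  moreover have "P \<subseteq> Pow (carrier L)"
    unfolding P_def using l_coset_closed[OF NL] by blast
  ultimately have "generate (BijGroup (carrier L)) (left_translation L ` carrier L)
      \<subseteq> {f \<in> Bij (carrier L). (\<lambda>A. f ` A) ` P = P}"
    by (intro B.generate_subgroup_incl subgroup_family_stabilizer)
  then show ?thesis
    using f unfolding P_def by blast
qed

end

theorem theorem1p2:
  fixes L :: "('a, 'b) monoid_scheme"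
  assumes "loop L"
    and "abstract_simple_group (left_mult_group L)"
  shows "simple_loop L"
proof -
  interpret loop L by fact
  interpret B: group "BijGroup (carrier L)" by (rule group_BijGroup)
  define H where "H = generate (BijGroup (carrier L)) (left_translation L ` carrier L)"
  have H: "subgroup H (BijGroup (carrier L))"
    unfolding H_def using left_translation_in_BijGroup by (intro B.generate_is_subgroup) blast
  have translation_in_H: "left_translation L a \<in> H" if "a \<in> carrier L" for a
    unfolding H_def using that by (intro generate.incl) blast
  have "N = {\<one>\<^bsub>L\<^esub>} \<or> N = carrier L" if N: "normal_subloop N L" for N
  proof -
    have sub: "subloop N L" and NL: "N \<subseteq> carrier L"
      using N by (auto simp: normal_subloop_def subloop_def)
    note one_N = subloop_one_mem[OF sub]
    define P where "P = (\<lambda>b. b <#\<^bsub>L\<^esub> N) ` carrier L"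
    define K where "K = {f \<in> H. \<forall>A\<in>P. f ` A = A}"
    have P: "P \<subseteq> Pow (carrier L)"
      unfolding P_def using l_coset_closed[OF NL] by blast
    have "f ` A \<in> P" if "f \<in> H" "A \<in> P" for f A
      using left_mult_group_permutes_cosets[OF N, of f] that unfolding P_def H_def by blast
    then have "K \<lhd> left_mult_group L"
      unfolding K_def left_mult_group_eq H_def[symmetric] by (rule normal_family_kernel[OF P H])
    then have "K = {\<one>\<^bsub>left_mult_group L\<^esub>} \<or> K = carrier (left_mult_group L)"
      using assms(2) by (simp add: abstract_simple_group_def)
    then consider "K = {\<lambda>x\<in>carrier L. x}" | "K = H"
      by (auto simp: left_mult_group_eq H_def BijGroup_def)
    then show ?thesis
    proof cases
      case 1
      have "n = \<one>\<^bsub>L\<^esub>" if n: "n \<in> N" for n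
      proof -
        have nL: "n \<in> carrier L" using n NL by blast
        have "left_translation L n ` A = A" if A: "A \<in> P" for A
        proof -
          have "left_translation L n ` A = n <#\<^bsub>L\<^esub> A"
            using A P by (intro l_coset_eq_image[symmetric]) blast
          also have "\<dots> = A"
            using A normal_subloop_l_coset_absorb[OF N n] by (auto simp: P_def)
          finally show ?thesis .
        qed
        then have "left_translation L n \<in> K"
          using translation_in_H[OF nL] by (simp add: K_def)
        \<comment> \<open>Translation by \<open>n\<close> is now the identity permutation; its value
          at the identity element is also \<open>n\<close>.\<close>
        with 1 have "left_translation L n \<one>\<^bsub>L\<^esub> = \<one>\<^bsub>L\<^esub>"
          using one_closed by simp
        then show ?thesis
          using nL one_closed r_one by (simp add: left_translation_def)
      qed
      with one_N show ?thesis by blast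
    next
      case 2
      \<comment> \<open>\<open>N\<close> is the coset of the identity element, so the kernel fixes
        it.\<close>
      have "N \<in> P"
        unfolding P_def using one_l_coset[OF NL] one_closed by force
      have "a \<in> N" if a: "a \<in> carrier L" for a
      proof -
        \<comment> \<open>Since \<open>N\<close> contains the identity element, its image under
          translation by \<open>a\<close> contains \<open>a\<close>.\<close>
        have "left_translation L a ` N = N"
          using translation_in_H[OF a] 2 \<open>N \<in> P\<close> by (auto simp: K_def)
        moreover have "left_translation L a \<one>\<^bsub>L\<^esub> = a"
          using a one_closed r_one by (simp add: left_translation_def)
        ultimately show ?thesis
          using one_N by (metis imageI)
      qed
      with NL show ?thesis by blast
    qed
  qed
  then show ?thesis
    using assms(1) by (simp add: simple_loop_def)
qed

end
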